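(* For every integer $n\ge 0$ and every $p\in\mathbb{Z}$, $$\beta_{n,\lambda}^{(p)}(x)=\sum_{k=0}^{n}\frac{\lambda^{k}(1)_{k+1,1/\lambda}}{(k+1)^{p}}\sum_{j=0}^{n}\binom{n}{j}(-1)^{j}S_{2,\lambda}(j,k)\,(x)_{n-j,-\lambda}.$$
   Context: Let $\lambda$ be a nonzero real number. For $\mu\in\mathbb{R}$, $(x)_{0,\mu}=1$, $(x)_{n,\mu}=x(x-\mu)\cdots(x-(n-1)\mu)$ for $n\ge1$, and $e_\mu^x(t)=\sum_{k\ge0}(x)_{k,\mu}t^k/k!$ (formal power series in $t$), $e_\mu(t)=e_\mu^1(t)$. The degenerate Stirling numbers of the second kind are defined by $(x)_{n,\lambda}=\sum_{k=0}^n S_{2,\lambda}(n,k)(x)_k$ where $(x)_k=x(x-1)\cdots(x-k+1)$, with $S_{2,\lambda}(n,k)=0$ for $k>n$. For $k\in\mathbb{Z}$, the degenerate polylogarithm is $\mathrm{Li}_{k,\lambda}(y)=\sum_{n\ge1}\frac{(-\lambda)^{n-1}(1)_{n,1/\lambda}}{(n-1)!\,n^k}y^n$. The degenerate poly-Bernoulli polynomials of index $k$ are defined by $\frac{\mathrm{Li}_{k,\lambda}(1-e_\lambda(-t))}{1-e_\lambda(-t)}e_\lambda^{-x}(-t)=\sum_{n\ge0}\beta^{(k)}_{n,\lambda}(x)\frac{t^n}{n!}$. *)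

theory Defs
  imports Complex_Main "HOL-Computational_Algebra.Formal_Power_Series"
begin

definition degen_falling :: "real \<Rightarrow> nat \<Rightarrow> real \<Rightarrow> real" where
  "degen_falling x n \<mu> = (\<Prod>i<n. x - real i * \<mu>)"

abbreviation falling :: "real \<Rightarrow> nat \<Rightarrow> real" where
  "falling x k \<equiv> degen_falling x k 1"

text \<open>\<open>degen_exp \<mu> x\<close> is the series $e_\mu^x(t)$; \<open>lam\<close> is the paper's $\lambda$.\<close>

definition degen_exp :: "real \<Rightarrow> real \<Rightarrow> real fps" where
  "degen_exp \<mu> x = Abs_fps (\<lambda>k. degen_falling x k \<mu> / fact k)"

text \<open>The coefficients of the expansion in falling factorials, defined by that expansion;
  existence and uniqueness are shown in \<open>degen_stirling2_ex1\<close> below.\<close>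

definition degen_stirling2 :: "real \<Rightarrow> nat \<Rightarrow> nat \<Rightarrow> real" where
  "degen_stirling2 lam =
     (THE S. (\<forall>n x. degen_falling x n lam = (\<Sum>k=0..n. S n k * falling x k)) \<and>
             (\<forall>n k. k > n \<longrightarrow> S n k = 0))"

definition degen_polylog :: "int \<Rightarrow> real \<Rightarrow> real fps" where
  "degen_polylog p lam = Abs_fps (\<lambda>n. if n = 0 then 0 else
     (- lam) ^ (n - 1) * degen_falling 1 n (1 / lam) / (fact (n - 1) * real n powi p))"

text \<open>The denominator has zero constant term; it divides the numerator
  (\<open>degen_poly_bernoulli_quotient\<close> below), so that the library division of
  power series is the exact quotient.\<close>

definition degen_poly_bernoulli_gf :: "int \<Rightarrow> real \<Rightarrow> real \<Rightarrow> real fps" where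
  "degen_poly_bernoulli_gf p lam x =
     (let u = 1 - (degen_exp lam 1 oo (- fps_X))
      in (degen_polylog p lam oo u) / u * (degen_exp lam (- x) oo (- fps_X)))"

definition degen_poly_bernoulli :: "int \<Rightarrow> nat \<Rightarrow> real \<Rightarrow> real \<Rightarrow> real" where
  "degen_poly_bernoulli p n lam x = fact n * fps_nth (degen_poly_bernoulli_gf p lam x) n"


lemma falling_eq_0: "m < k \<Longrightarrow> falling (real m) k = 0"
  unfolding degen_falling_def by (rule prod_zero) auto

lemma falling_self_nonzero: "falling (real m) m \<noteq> 0"
  unfolding degen_falling_def by auto

lemma falling_expansion_unique:
  assumes "\<And>x. (\<Sum>k=0..n. a k * falling x k) = (\<Sum>k=0..n. b k * falling x k)"
  shows "k \<le> n \<Longrightarrow> a k = b k"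
proof (induction k rule: less_induct)
  case (less m)
  have split: "(\<Sum>k=0..n. c k * falling (real m) k) =
      (\<Sum>k<m. c k * falling (real m) k) + c m * falling (real m) m" for c :: "nat \<Rightarrow> real"
  proof -
    have "(\<Sum>k=0..n. c k * falling (real m) k) = (\<Sum>k\<le>m. c k * falling (real m) k)"
      using less.prems by (intro sum.mono_neutral_right) (auto simp: falling_eq_0)
    also have "\<dots> = (\<Sum>k<m. c k * falling (real m) k) + c m * falling (real m) m"
      by (simp add: lessThan_Suc_atMost[symmetric])
    finally show ?thesis .
  qed
  have "(\<Sum>k<m. a k * falling (real m) k) = (\<Sum>k<m. b k * falling (real m) k)"
    using less by (intro sum.cong) auto
  with assms[of "real m"] show ?case
    unfolding split using falling_self_nonzero[of m] by simp
qed

lemma falling_expansion_ex: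
  "\<exists>c. (\<forall>x. degen_falling x n lam = (\<Sum>k=0..n. c k * falling x k)) \<and> (\<forall>k>n. c k = 0)"
proof (induction n)
  case 0
  show ?case
    by (rule exI[of _ "\<lambda>k. if k = 0 then 1 else 0"]) (simp add: degen_falling_def)
next
  case (Suc n)
  then obtain c where c: "\<And>x. degen_falling x n lam = (\<Sum>k=0..n. c k * falling x k)"
    and c0: "\<And>k. k > n \<Longrightarrow> c k = 0" by blast
  define d where "d k = (if k = 0 then 0 else c (k - 1)) + (real k - real n * lam) * c k" for k
  have "degen_falling x (Suc n) lam = (\<Sum>k=0..Suc n. d k * falling x k)" for x
  proof -
    have s: "falling x (Suc k) = falling x k * (x - real k)" for k
      by (simp add: degen_falling_def)
    have "(\<Sum>k=0..Suc n. d k * falling x k) =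
        (\<Sum>k=0..Suc n. (if k = 0 then 0 else c (k - 1)) * falling x k) +
        (\<Sum>k=0..Suc n. (real k - real n * lam) * c k * falling x k)"
      by (simp add: d_def distrib_right sum.distrib)
    also have "(\<Sum>k=0..Suc n. (if k = 0 then 0 else c (k - 1)) * falling x k) =
        (\<Sum>k=0..n. c k * falling x (Suc k))"
      by (subst sum.atLeast0_atMost_Suc_shift) simp
    also have "(\<Sum>k=0..Suc n. (real k - real n * lam) * c k * falling x k) =
        (\<Sum>k=0..n. (real k - real n * lam) * c k * falling x k)"
      by (simp add: c0)
    also have "(\<Sum>k=0..n. c k * falling x (Suc k)) +
        (\<Sum>k=0..n. (real k - real n * lam) * c k * falling x k) =
        (\<Sum>k=0..n. c k * falling x k) * (x - real n * lam)"
      unfolding sum_distrib_right sum.distrib[symmetric]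
      by (intro sum.cong) (auto simp: s algebra_simps)
    also have "\<dots> = degen_falling x (Suc n) lam"
      unfolding c[symmetric] by (simp add: degen_falling_def)
    finally show ?thesis ..
  qed
  moreover have "\<forall>k>Suc n. d k = 0"
    by (auto simp: d_def c0)
  ultimately show ?case by blast
qed

lemma degen_stirling2_ex1:
  "\<exists>!S. (\<forall>n x. degen_falling x n lam = (\<Sum>k=0..n. S n k * falling x k)) \<and>
        (\<forall>n k. k > n \<longrightarrow> S n k = (0::real))"
proof (rule ex_ex1I)
  show "\<exists>S. (\<forall>n x. degen_falling x n lam = (\<Sum>k=0..n. S n k * falling x k)) \<and>
        (\<forall>n k. k > n \<longrightarrow> S n k = (0::real))"
  proof -
    have "\<forall>n. \<exists>c. (\<forall>x. degen_falling x n lam = (\<Sum>k=0..n. c k * falling x k)) \<and> (\<forall>k>n. c k = 0)"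
      using falling_expansion_ex by blast
    from choice[OF this] show ?thesis by blast
  qed
next
  fix S T :: "nat \<Rightarrow> nat \<Rightarrow> real"
  assume S: "(\<forall>n x. degen_falling x n lam = (\<Sum>k=0..n. S n k * falling x k)) \<and>
        (\<forall>n k. k > n \<longrightarrow> S n k = 0)"
    and T: "(\<forall>n x. degen_falling x n lam = (\<Sum>k=0..n. T n k * falling x k)) \<and>
        (\<forall>n k. k > n \<longrightarrow> T n k = 0)"
  have "S n k = T n k" for n k
  proof (cases "k \<le> n")
    case True
    show ?thesis
      by (rule falling_expansion_unique[OF _ True]) (use S T in metis)
  next
    case False
    then show ?thesis using S T by simp
  qed
  then show "S = T" by blast
qed

lemma degen_stirling2_expansion:
    "degen_falling x n lam = (\<Sum>k=0..n. degen_stirling2 lam n k * falling x k)"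
  and degen_stirling2_eq_0: "k > n \<Longrightarrow> degen_stirling2 lam n k = 0"
  using theI'[OF degen_stirling2_ex1[of lam]] unfolding degen_stirling2_def[symmetric] by blast+

lemma degen_poly_bernoulli_quotient:
  fixes lam :: real
  defines "u \<equiv> 1 - (degen_exp lam 1 oo (- fps_X))"
  shows "(degen_polylog p lam oo u) / u * u = degen_polylog p lam oo u"
proof -
  have u0: "fps_nth u 0 = 0"
    by (simp add: u_def degen_exp_def degen_falling_def)
  have "degen_polylog p lam = fps_X * fps_shift 1 (degen_polylog p lam)"
    by (rule fps_ext) (simp add: degen_polylog_def)
  then have "degen_polylog p lam oo u = (fps_X * fps_shift 1 (degen_polylog p lam)) oo u"
    by simp
  also have "\<dots> = u * (fps_shift 1 (degen_polylog p lam) oo u)"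
    using u0 by (simp add: fps_compose_mult_distrib)
  finally have "u dvd degen_polylog p lam oo u" by simp
  then show ?thesis by simp
qed

end

theory Submission
  imports Defs
begin

text \<open>Both $e_\lambda^x(t)$ and $(1 + (e_\lambda(t) - 1))^x$ solve $(1 + \lambda t) f' = x f$,
  $f(0) = 1$, so they agree. Comparing coefficients of falling factorials of $x$ gives
  $(e_\lambda(t) - 1)^k / k! = \sum_j S_{2,\lambda}(j,k) t^j / j!$. Substituting $-t$ for $t$ turns
  the expansion of the polylogarithm quotient in powers of $1 - e_\lambda(-t)$ into one in
  degenerate Stirling numbers, and $e_\lambda^{-x}(-t) = e_{-\lambda}^{x}(t)$.\<close>

text \<open>Coefficientwise this is the recursion
  \<open>(x)_{n+1,lam} = (x)_{n,lam} * (x - n * lam)\<close> divided by \<open>n!\<close>.\<close>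

lemma degen_exp_ODE:
  "(1 + fps_const lam * fps_X) * fps_deriv (degen_exp lam x) = fps_const x * degen_exp lam x"
proof (rule fps_ext)
  fix n
  have "fps_nth (degen_exp lam x) (Suc n) * real (Suc n) =
      fps_nth (degen_exp lam x) n * (x - real n * lam)"
    by (simp add: degen_exp_def degen_falling_def field_simps del: of_nat_Suc)
  then show "fps_nth ((1 + fps_const lam * fps_X) * fps_deriv (degen_exp lam x)) n =
      fps_nth (fps_const x * degen_exp lam x) n"
    by (cases n) (simp_all add: distrib_right mult.assoc algebra_simps)
qed

text \<open>The factor \<open>1 + lam * X\<close> has constant term 1, so the equation determines
  coefficient \<open>n + 1\<close> from coefficient \<open>n\<close>.\<close>

lemma degen_exp_ODE_unique:
  assumes ode: "(1 + fps_const lam * fps_X) * fps_deriv f = fps_const x * f"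
    and f0: "fps_nth f 0 = 1"
  shows "f = degen_exp lam x"
proof (rule fps_ext)
  fix n
  have rec: "fps_nth f (Suc n) * real (Suc n) = fps_nth f n * (x - real n * lam)" for n
    using arg_cong[OF ode, of "\<lambda>g. fps_nth g n"]
    by (cases n) (simp_all add: distrib_right mult.assoc algebra_simps)
  show "fps_nth f n = fps_nth (degen_exp lam x) n"
  proof (induction n)
    case 0
    show ?case by (simp add: f0 degen_exp_def degen_falling_def)
  next
    case (Suc n)
    have "fps_nth f (Suc n) = fps_nth f n * (x - real n * lam) / real (Suc n)"
      using rec[of n] by (simp add: field_simps)
    then show ?case
      by (simp add: Suc.IH degen_exp_def degen_falling_def field_simps del: of_nat_Suc)
  qed
qed

lemma degen_exp_nth: "fps_nth (degen_exp lam x) n = degen_falling x n lam / fact n"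
  by (simp add: degen_exp_def)

lemma degen_exp_nth_0 [simp]: "fps_nth (degen_exp lam x) 0 = 1"
  by (simp add: degen_exp_def degen_falling_def)

text \<open>\<open>fps_binomial x\<close> is the series of \<open>(1 + X)^x\<close>, which makes
  sense of a real power of \<open>degen_exp lam 1\<close>.\<close>

lemma degen_exp_eq_binomial_compose:
  "degen_exp lam x = fps_binomial x oo (degen_exp lam 1 - 1)"
proof (rule degen_exp_ODE_unique[symmetric])
  define e where "e = degen_exp lam 1"
  define B where "B = fps_binomial x oo (e - 1)"
  define D where "D = fps_deriv (fps_binomial x) oo (e - 1)"
  have e0: "fps_nth (e - 1) 0 = 0" by (simp add: e_def)
  have "(1 + fps_X) * fps_deriv (fps_binomial x) = fps_const x * fps_binomial x"
    by (simp add: fps_binomial_deriv fps_divide_unit mult_ac inverse_mult_eq_1')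
  then have "((1 + fps_X) * fps_deriv (fps_binomial x)) oo (e - 1)
      = (fps_const x * fps_binomial x) oo (e - 1)"
    by simp
  \<comment> \<open>Substituting \<open>e - 1\<close> for \<open>X\<close> turns the factor
    \<open>1 + X\<close> into \<open>e\<close>.\<close>
  then have eD: "e * D = fps_const x * B"
    using e0 by (simp add: fps_compose_mult_distrib fps_compose_add_distrib B_def D_def)
  \<comment> \<open>By the chain rule \<open>B' = D * e'\<close>, and the differential equation of
    \<open>e\<close> itself, with exponent 1, replaces \<open>(1 + lam * X) * e'\<close> by
    \<open>e\<close>.\<close>
  have "(1 + fps_const lam * fps_X) * fps_deriv B
      = D * ((1 + fps_const lam * fps_X) * fps_deriv e)"
    using e0 by (simp add: B_def D_def fps_compose_deriv mult_ac)
  also have "\<dots> = fps_const x * B"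
    using eD by (simp add: e_def degen_exp_ODE mult.commute[of D])
  finally show "(1 + fps_const lam * fps_X) * fps_deriv (fps_binomial x oo (degen_exp lam 1 - 1))
      = fps_const x * (fps_binomial x oo (degen_exp lam 1 - 1))"
    by (simp add: B_def e_def)
qed simp

lemma gbinomial_eq_falling: "x gchoose k = falling x k / fact k"
  by (simp add: gbinomial_prod_rev degen_falling_def atLeast0LessThan)

lemma degen_exp_minus_1_power_nth:
  "fps_nth ((degen_exp lam 1 - 1) ^ k) j = fact k * degen_stirling2 lam j k / fact j"
proof (cases "k \<le> j")
  case True
  have "degen_stirling2 lam j k = fact j / fact k * fps_nth ((degen_exp lam 1 - 1) ^ k) j"
  proof (rule falling_expansion_unique[OF _ True])
    fix x
    have "degen_falling x j lam = fact j * fps_nth (degen_exp lam x) j"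
      by (simp add: degen_exp_def)
    \<comment> \<open>The coefficient of the composition is a finite sum, hence an expansion in
      falling factorials valid for every \<open>x\<close>; uniqueness of such expansions then
      applies.\<close>
    also have "\<dots> = (\<Sum>k=0..j. fact j / fact k * fps_nth ((degen_exp lam 1 - 1) ^ k) j
        * falling x k)"
      by (subst degen_exp_eq_binomial_compose)
        (simp add: fps_compose_nth gbinomial_eq_falling sum_distrib_left mult_ac)
    finally show "(\<Sum>k=0..j. degen_stirling2 lam j k * falling x k) =
        (\<Sum>k=0..j. fact j / fact k * fps_nth ((degen_exp lam 1 - 1) ^ k) j * falling x k)"
      by (simp flip: degen_stirling2_expansion)
  qed
  then show ?thesis by simp
next
  \<comment> \<open>The \<open>k\<close>-th power of a series without constant term has no
    coefficients below \<open>k\<close>, so both sides are 0.\<close>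
  case False
  then show ?thesis
    by (simp add: degen_stirling2_eq_0 startsby_zero_power_prefix)
qed

text \<open>The sign \<open>(-1)^k\<close> comes from \<open>1 - f = - (f - 1)\<close>, the sign
  \<open>(-1)^j\<close> from the substitution of \<open>-X\<close>.\<close>

lemma one_minus_degen_exp_power_nth:
  "fps_nth ((1 - (degen_exp lam 1 oo (- fps_X))) ^ k) j =
    (-1) ^ k * (-1) ^ j * fact k * degen_stirling2 lam j k / fact j"
proof -
  have "(1 - (degen_exp lam 1 oo (- fps_X))) ^ k = (- ((degen_exp lam 1 - 1) oo (- fps_X))) ^ k"
    by (simp add: fps_compose_sub_distrib)
  also have "\<dots> = fps_const ((-1) ^ k) * ((degen_exp lam 1 - 1) ^ k oo (- fps_X))"
    by (subst power_minus) (simp add: fps_compose_power flip: fps_const_power fps_const_neg)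
  finally show ?thesis
    by (simp add: fps_compose_uminus' degen_exp_minus_1_power_nth)
qed

text \<open>Each of the \<open>n\<close> signs is absorbed by one factor:
  \<open>- (- x - i * lam) = x - i * (- lam)\<close>.\<close>

lemma degen_exp_uminus: "degen_exp lam (- x) oo (- fps_X) = degen_exp (- lam) x"
proof (rule fps_ext)
  fix n
  have "(-1) ^ n * degen_falling (- x) n lam = degen_falling x n (- lam)"
    unfolding degen_falling_def by (induction n) (simp_all add: algebra_simps)
  then show "fps_nth (degen_exp lam (- x) oo (- fps_X)) n = fps_nth (degen_exp (- lam) x) n"
    by (simp add: fps_compose_uminus' degen_exp_def)
qed

text \<open>The polylogarithm has no constant term, so a factor \<open>X\<close> splits off and
  becomes \<open>u\<close> under composition. It cancels because \<open>u\<close> has linear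
  coefficient 1 and so is nonzero.\<close>

lemma degen_polylog_quotient:
  fixes lam :: real
  defines "u \<equiv> 1 - (degen_exp lam 1 oo (- fps_X))"
  shows "(degen_polylog p lam oo u) / u = fps_shift 1 (degen_polylog p lam) oo u"
proof -
  have u0: "fps_nth u 0 = 0"
    by (simp add: u_def)
  have "fps_nth u 1 = 1"
    by (simp add: u_def fps_compose_uminus' degen_exp_def degen_falling_def)
  then have "u \<noteq> 0" by auto
  have "degen_polylog p lam = fps_X * fps_shift 1 (degen_polylog p lam)"
    by (rule fps_ext) (simp add: degen_polylog_def)
  then have "degen_polylog p lam oo u = (fps_X * fps_shift 1 (degen_polylog p lam)) oo u"
    by simp
  also have "\<dots> = u * (fps_shift 1 (degen_polylog p lam) oo u)"
    using u0 by (simp add: fps_compose_mult_distrib)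
  finally show ?thesis
    using \<open>u \<noteq> 0\<close> by simp
qed

text \<open>The sum runs up to \<open>n\<close> rather than \<open>j\<close>, so that its range does
  not depend on \<open>j\<close> and the double sum can later be interchanged.\<close>

lemma degen_polylog_quotient_nth:
  fixes lam :: real
  defines "u \<equiv> 1 - (degen_exp lam 1 oo (- fps_X))"
  assumes "j \<le> n"
  shows "fps_nth ((degen_polylog p lam oo u) / u) j =
    (\<Sum>k=0..n. lam ^ k * degen_falling 1 (k + 1) (1 / lam) / real (k + 1) powi p *
      ((-1) ^ j * degen_stirling2 lam j k / fact j))"
proof -
  have sgn: "(- lam) ^ k * (-1) ^ k = lam ^ k" for k
    by (simp flip: power_mult_distrib)
  have "fps_nth ((degen_polylog p lam oo u) / u) j =
      (\<Sum>k=0..j. fps_nth (degen_polylog p lam) (k + 1) * fps_nth (u ^ k) j)"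
    unfolding u_def degen_polylog_quotient by (simp add: fps_compose_nth)
  also have "\<dots> = (\<Sum>k=0..j. lam ^ k * degen_falling 1 (k + 1) (1 / lam) / real (k + 1) powi p *
      ((-1) ^ j * degen_stirling2 lam j k / fact j))"
    \<comment> \<open>After the shift by one, the \<open>k!\<close> in the denominator of the
      polylogarithm coefficient cancels the \<open>k!\<close> of the power, and
      \<open>(-lam)^k * (-1)^k\<close> becomes \<open>lam^k\<close>.\<close>
    unfolding u_def one_minus_degen_exp_power_nth
    by (intro sum.cong refl) (simp add: degen_polylog_def sgn[symmetric] del: of_nat_Suc)
  \<comment> \<open>The added terms have \<open>k > j\<close>, where the Stirling numbers
    vanish.\<close>
  also have "\<dots> = (\<Sum>k=0..n. lam ^ k * degen_falling 1 (k + 1) (1 / lam) / real (k + 1) powi p *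
      ((-1) ^ j * degen_stirling2 lam j k / fact j))"
    using assms by (intro sum.mono_neutral_left) (auto simp: degen_stirling2_eq_0)
  finally show ?thesis .
qed

theorem theorem9:
  fixes lam x :: real and n :: nat and p :: int
  assumes "lam \<noteq> 0"
  shows "degen_poly_bernoulli p n lam x =
    (\<Sum>k=0..n. lam ^ k * degen_falling 1 (k + 1) (1 / lam) / real (k + 1) powi p *
      (\<Sum>j=0..n. real (n choose j) * (-1) ^ j * degen_stirling2 lam j k
                 * degen_falling x (n - j) (- lam)))"
proof -
  define c where "c k = lam ^ k * degen_falling 1 (k + 1) (1 / lam) / real (k + 1) powi p" for k
  \<comment> \<open>Cauchy product of the quotient with \<open>degen_exp (- lam) x\<close>.\<close>
  have "degen_poly_bernoulli p n lam x =
      (\<Sum>j=0..n. fact n * ((\<Sum>k=0..n. c k * ((-1) ^ j * degen_stirling2 lam j k / fact j)) *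
        (degen_falling x (n - j) (- lam) / fact (n - j))))"
    unfolding degen_poly_bernoulli_def degen_poly_bernoulli_gf_def Let_def degen_exp_uminus
      fps_mult_nth sum_distrib_left
    by (intro sum.cong refl) (simp add: degen_polylog_quotient_nth c_def degen_exp_nth)
  also have "\<dots> = (\<Sum>j=0..n. \<Sum>k=0..n. c k * (real (n choose j) * (-1) ^ j * degen_stirling2 lam j k
                 * degen_falling x (n - j) (- lam)))"
    \<comment> \<open>The factor \<open>n! / (j! * (n - j)!)\<close> is the binomial coefficient, as
      \<open>j \<le> n\<close>.\<close>
    unfolding sum_distrib_left sum_distrib_right
    by (intro sum.cong refl) (simp add: binomial_fact)
  also have "\<dots> = (\<Sum>k=0..n. c k * (\<Sum>j=0..n. real (n choose j) * (-1) ^ j * degen_stirling2 lam j k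
                 * degen_falling x (n - j) (- lam)))"
    unfolding sum_distrib_left by (rule sum.swap)
  finally show ?thesis
    unfolding c_def .
qed

end
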